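(* Let $G$ be a König–Egerváry graph and $G_0=G-N[\mathrm{core}(G)]$. Then the following are equivalent: (i) $G_0$ has a unique perfect matching; (ii) the $\alpha$-critical edges of $G_0$ form a maximal matching in $G_0$; (iii) $\xi(G)+\eta(G)=\alpha(G)$; (iv) $\sigma(G)+\eta(G)=\mu(G)$; (v) $\xi(G)+2\eta(G)+\sigma(G)=n(G)$.
   Context: All graphs are finite and simple; "graph" means a connected graph with at least one edge ($G_0$ need not be connected; definitions apply to it as well). $\alpha(G)$ is the stability number, $\mu(G)$ the maximum matching size, $n(G)=|V(G)|$; $G$ is König–Egerváry if $\alpha(G)+\mu(G)=n(G)$. $\Omega(G)$ is the set of maximum stable sets, $\mathrm{core}(G)=\bigcap\{S:S\in\Omega(G)\}$, $\xi(G)=|\mathrm{core}(G)|$, $\sigma(G)=\left|\bigcap\{V(G)-S:S\in\Omega(G)\}\right|$. For $A\subseteq V(G)$, $N(A)$ is the set of vertices adjacent to some vertex of $A$, $N[A]=A\cup N(A)$, and $G-A$ is the subgraph induced by $V(G)-A$. An edge $e$ of a graph $H$ is $\alpha$-critical in $H$ if $\alpha(H-e)>\alpha(H)$ ($H-e$ being $H$ with $e$ deleted); $\eta(G)$ is the number of $\alpha$-critical edges of $G$. A maximal matching is one not properly contained in another matching. *)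

theory Defs
  imports Main "HOL-Library.Ramsey"
begin

text \<open>
  A graph is a pair of a vertex set and a set of edges, each edge being a two-element set of
  vertices.
\<close>

type_synonym 'a graph = "'a set \<times> 'a set set"

abbreviation verts :: "'a graph \<Rightarrow> 'a set" where
  "verts G \<equiv> fst G"

abbreviation edges :: "'a graph \<Rightarrow> 'a set set" where
  "edges G \<equiv> snd G"

definition simple_graph :: "'a graph \<Rightarrow> bool" where
  "simple_graph G \<longleftrightarrow> finite (verts G) \<and> edges G \<subseteq> nsets (verts G) 2"

definition connected_graph :: "'a graph \<Rightarrow> bool" where
  "connected_graph G \<longleftrightarrow> verts G \<noteq> {} \<and>
     (\<forall>u\<in>verts G. \<forall>v\<in>verts G. (u, v) \<in> {(x, y). {x, y} \<in> edges G}\<^sup>*)"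

definition order :: "'a graph \<Rightarrow> nat" where
  "order G = card (verts G)"

definition stable :: "'a graph \<Rightarrow> 'a set \<Rightarrow> bool" where
  "stable G S \<longleftrightarrow> S \<subseteq> verts G \<and> indep S (edges G)"

definition alpha :: "'a graph \<Rightarrow> nat" where
  "alpha G = Max {card S |S. stable G S}"

definition matching :: "'a graph \<Rightarrow> 'a set set \<Rightarrow> bool" where
  "matching G M \<longleftrightarrow> M \<subseteq> edges G \<and> pairwise disjnt M"

definition mu :: "'a graph \<Rightarrow> nat" where
  "mu G = Max {card M |M. matching G M}"

definition perfect_matching :: "'a graph \<Rightarrow> 'a set set \<Rightarrow> bool" where
  "perfect_matching G M \<longleftrightarrow> matching G M \<and> \<Union> M = verts G"

definition maximal_matching :: "'a graph \<Rightarrow> 'a set set \<Rightarrow> bool" where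
  "maximal_matching G M \<longleftrightarrow> matching G M \<and> \<not> (\<exists>M'. matching G M' \<and> M \<subset> M')"

definition koenig_egervary :: "'a graph \<Rightarrow> bool" where
  "koenig_egervary G \<longleftrightarrow> alpha G + mu G = order G"

definition Omega :: "'a graph \<Rightarrow> 'a set set" where
  "Omega G = {S. stable G S \<and> card S = alpha G}"

definition core :: "'a graph \<Rightarrow> 'a set" where
  "core G = \<Inter> (Omega G)"

definition xi :: "'a graph \<Rightarrow> nat" where
  "xi G = card (core G)"

definition sigma :: "'a graph \<Rightarrow> nat" where
  "sigma G = card (\<Inter>S\<in>Omega G. verts G - S)"

definition nbhd :: "'a graph \<Rightarrow> 'a set \<Rightarrow> 'a set" where
  "nbhd G A = {v \<in> verts G. \<exists>a\<in>A. {a, v} \<in> edges G}"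

definition closed_nbhd :: "'a graph \<Rightarrow> 'a set \<Rightarrow> 'a set" where
  "closed_nbhd G A = A \<union> nbhd G A"

definition delete_verts :: "'a graph \<Rightarrow> 'a set \<Rightarrow> 'a graph" where
  "delete_verts G A = (verts G - A, {e \<in> edges G. e \<subseteq> verts G - A})"

definition delete_edge :: "'a graph \<Rightarrow> 'a set \<Rightarrow> 'a graph" where
  "delete_edge G e = (verts G, edges G - {e})"

definition critical_edges :: "'a graph \<Rightarrow> 'a set set" where
  "critical_edges G = {e \<in> edges G. alpha (delete_edge G e) > alpha G}"

definition eta :: "'a graph \<Rightarrow> nat" where
  "eta G = card (critical_edges G)"

end

theory Submission
  imports Defs
begin

text \<open>
  Since \<open>\<alpha> + \<mu> = n\<close>, a maximum matching \<open>M\<close> matches the complement of every maximum stable set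
  \<open>S\<close> into \<open>S\<close>. Hence \<open>N(core)\<close> is exactly the set of vertices avoided by all maximum stable sets,
  and \<open>M\<close> restricts to a perfect matching of \<open>G\<^sub>0\<close>, of size \<open>m\<close> say, with \<open>\<alpha> = \<xi> + m\<close>,
  \<open>\<mu> = \<sigma> + m\<close> and \<open>n = \<xi> + \<sigma> + 2m\<close>; so each numerical condition says \<open>\<eta> = m\<close>. The critical
  edges of \<open>G\<close> and \<open>G\<^sub>0\<close> coincide and lie in every perfect matching of \<open>G\<^sub>0\<close>, so \<open>\<eta> = m\<close> means that
  they form a perfect matching, which is then unique and maximal. Conversely, let \<open>ab\<close> be an edge of
  the unique perfect matching, and let \<open>S\<close>, \<open>T\<close> be maximum stable sets containing \<open>a\<close>, \<open>b\<close>. Put an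
  arc from \<open>u\<close> to \<open>v\<close> in \<open>S - T\<close> if \<open>u\<close> is adjacent to the partner of \<open>v \<noteq> u\<close>. Uniqueness makes
  this digraph acyclic, and if \<open>D\<close> is the set reachable from \<open>a\<close>, then \<open>S \<inter> T\<close>, \<open>D\<close>, \<open>b\<close> and the
  partners of \<open>(S - T) - D\<close> together form a set of size \<open>\<alpha> + 1\<close> spanning only the edge \<open>ab\<close>.
\<close>

section \<open>Simple graphs, stable sets and attained extrema\<close>

lemma simple_graph_finite_verts: "simple_graph G \<Longrightarrow> finite (verts G)"
  by (simp add: simple_graph_def)

lemma simple_graph_edge_subset: "simple_graph G \<Longrightarrow> e \<in> edges G \<Longrightarrow> e \<subseteq> verts G"
  by (auto simp: simple_graph_def nsets_def)

lemma simple_graph_edgeE: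
  assumes "simple_graph G" "e \<in> edges G"
  obtains u v where "e = {u, v}" "u \<noteq> v" "u \<in> verts G" "v \<in> verts G"
proof -
  have "card e = 2" "e \<subseteq> verts G"
    using assms by (auto simp: simple_graph_def nsets_def)
  then show ?thesis
    using that by (auto simp: card_2_iff)
qed

lemma simple_graph_edge_neq: "simple_graph G \<Longrightarrow> {u, v} \<in> edges G \<Longrightarrow> u \<noteq> v"
  by (auto simp: simple_graph_def nsets_def)

lemma simple_graph_finite_edges: "simple_graph G \<Longrightarrow> finite (edges G)"
  by (meson finite_subset simple_graph_def finite_imp_finite_nsets)

lemma simple_graph_delete_edge: "simple_graph G \<Longrightarrow> simple_graph (delete_edge G e)"
  by (auto simp: simple_graph_def delete_edge_def)

lemma simple_graph_delete_verts: "simple_graph G \<Longrightarrow> simple_graph (delete_verts G A)"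
  by (auto simp: simple_graph_def delete_verts_def nsets_def)

lemma stable_subset: "stable G S \<Longrightarrow> T \<subseteq> S \<Longrightarrow> stable G T"
  by (auto simp: stable_def indep_def)

lemma stable_delete_edge:
  assumes "stable (delete_edge G e) S" "\<not> e \<subseteq> S"
  shows "stable G S"
proof -
  have "{v, w} \<noteq> e" if "v \<in> S" "w \<in> S" for v w
    using assms(2) that by blast
  then show ?thesis
    using assms(1) by (simp add: stable_def indep_def delete_edge_def)
qed

lemma finite_stable: "simple_graph G \<Longrightarrow> stable G S \<Longrightarrow> finite S"
  by (metis finite_subset simple_graph_def stable_def)

lemma stable_not_edge:
  assumes "simple_graph G" "stable G S" "u \<in> S" "v \<in> S"
  shows "{u, v} \<notin> edges G"
  using assms simple_graph_edge_neq[of G u v] by (auto simp: stable_def indep_def)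

lemma finite_stable_cards: "simple_graph G \<Longrightarrow> finite {card S |S. stable G S}"
  by (rule finite_subset[of _ "card ` Pow (verts G)"]) (auto simp: stable_def simple_graph_def)

lemma card_stable_le_alpha: "simple_graph G \<Longrightarrow> stable G S \<Longrightarrow> card S \<le> alpha G"
  unfolding alpha_def by (intro Max_ge finite_stable_cards) auto

lemma alpha_attained:
  assumes "simple_graph G"
  obtains S where "stable G S" "card S = alpha G"
proof -
  have "stable G {}" by (simp add: stable_def indep_def)
  then have "alpha G \<in> {card S |S. stable G S}"
    unfolding alpha_def using finite_stable_cards[OF assms] by (intro Max_in) auto
  then show ?thesis using that by auto
qed

lemma mu_attained:
  assumes "simple_graph G"
  obtains M where "matching G M" "card M = mu G"
proof -
  have "matching G {}" by (simp add: matching_def)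
  moreover have "finite {card M |M. matching G M}"
    by (rule finite_subset[of _ "card ` Pow (edges G)"])
      (auto simp: matching_def simple_graph_finite_edges[OF assms])
  ultimately have "mu G \<in> {card M |M. matching G M}"
    unfolding mu_def by (intro Max_in) auto
  then show ?thesis using that by auto
qed

section \<open>Matchings and their duality with stable sets\<close>

lemma finite_matching: "simple_graph G \<Longrightarrow> matching G M \<Longrightarrow> finite M"
  by (metis finite_subset matching_def simple_graph_finite_edges)

lemma matching_eq:
  "matching G M \<Longrightarrow> e \<in> M \<Longrightarrow> e' \<in> M \<Longrightarrow> x \<in> e \<Longrightarrow> x \<in> e' \<Longrightarrow> e = e'"
  unfolding matching_def pairwise_def disjnt_def by blast

lemma matching_edge: "matching G M \<Longrightarrow> e \<in> M \<Longrightarrow> e \<in> edges G"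
  by (auto simp: matching_def)

text \<open>A stable set contains no edge, so each edge of \<open>M\<close> has an end outside
  \<open>S\<close>; disjoint edges give distinct ends. This injection yields the bound \<alpha> +
  \<mu> \<le> n.\<close>

lemma matching_selector:
  assumes "simple_graph G" "stable G S" "matching G M"
  shows "\<exists>g. inj_on g M \<and> g ` M \<subseteq> verts G - S \<and> (\<forall>e\<in>M. g e \<in> e)"
proof -
  have "\<exists>x. x \<in> e \<and> x \<in> verts G - S" if "e \<in> M" for e
  proof -
    have e: "e \<in> edges G" using matching_edge[OF assms(3) that] .
    then obtain u v where uv: "e = {u, v}" "u \<in> verts G" "v \<in> verts G"
      using simple_graph_edgeE[OF assms(1)] by metis
    then have "u \<notin> S \<or> v \<notin> S"
      using stable_not_edge[OF assms(1,2)] e by metis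
    then show ?thesis using uv by blast
  qed
  then obtain g where g: "\<And>e. e \<in> M \<Longrightarrow> g e \<in> e \<and> g e \<in> verts G - S"
    by metis
  have "inj_on g M"
    using g matching_eq[OF assms(3)] by (metis inj_onI)
  then show ?thesis using g by blast
qed

lemma card_stable_matching_le:
  assumes "simple_graph G" "stable G S" "matching G M"
  shows "card S + card M \<le> order G"
proof -
  obtain g where "inj_on g M" "g ` M \<subseteq> verts G - S"
    using matching_selector[OF assms] by blast
  then have "card M \<le> card (verts G - S)"
    using assms(1) by (meson card_inj_on_le finite_Diff simple_graph_finite_verts)
  moreover have "card (verts G - S) + card S = card (verts G)"
    using assms by (metis add.commute card_Diff_subset card_mono finite_stable le_add_diff_inverse
        simple_graph_finite_verts stable_def)
  ultimately show ?thesis by (simp add: order_def)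
qed

text \<open>Equality makes the selector a bijection onto the complement of \<open>S\<close>. If both
  ends of an edge lay outside \<open>S\<close>, both would be selected, necessarily by that same
  edge, which selects only one.\<close>

lemma tight_matching_covers:
  assumes "simple_graph G" "stable G S" "matching G M" "card S + card M = order G"
    and "v \<in> verts G - S"
  shows "\<exists>w\<in>S. {v, w} \<in> M"
proof -
  obtain g where g: "inj_on g M" "g ` M \<subseteq> verts G - S" "\<And>e. e \<in> M \<Longrightarrow> g e \<in> e"
    using matching_selector[OF assms(1-3)] by blast
  have "card (verts G - S) = card M"
    using assms(1,2,4) by (simp add: card_Diff_subset finite_stable stable_def order_def)
  then have im: "g ` M = verts G - S"
    using g assms(1) by (metis card_image card_subset_eq finite_Diff simple_graph_finite_verts)
  then obtain e where e: "e \<in> M" "v = g e"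
    using assms(5) by auto
  then have "v \<in> e" using g by auto
  obtain w where w: "e = {v, w}" "v \<noteq> w" "w \<in> verts G"
    using simple_graph_edgeE[OF assms(1) matching_edge[OF assms(3) e(1)]] \<open>v \<in> e\<close>
    by (metis insertE insert_commute singletonD)
  have "w \<in> S"
  proof (rule ccontr)
    assume "w \<notin> S"
    then obtain e' where e': "e' \<in> M" "w = g e'"
      using im w(3) by blast
    then have "e' = e"
      using matching_eq[OF assms(3) e'(1) e(1)] g(3) w by auto
    then show False using e(2) e'(2) w(2) by simp
  qed
  then show ?thesis using e(1) w(1) by blast
qed

lemma perfect_matching_card:
  assumes "simple_graph G" "perfect_matching G M"
  shows "card (verts G) = 2 * card M"
proof -
  have m: "matching G M" "\<Union> M = verts G"
    using assms(2) by (auto simp: perfect_matching_def)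
  have "card e = 2" if "e \<in> M" for e
    using matching_edge[OF m(1) that] assms(1) by (auto simp: simple_graph_def nsets_def)
  then have "sum card M = 2 * card M" by simp
  moreover have "card (\<Union> M) = sum card M"
  proof (rule card_Union_disjoint)
    show "pairwise disjnt M" using m by (simp add: matching_def)
    show "finite e" if "e \<in> M" for e
      by (metis that \<open>\<And>e. e \<in> M \<Longrightarrow> card e = 2\<close> card.infinite zero_neq_numeral)
  qed
  ultimately show ?thesis using m by simp
qed

section \<open>Critical edges\<close>

text \<open>A tight matching that avoids \<open>e\<close> survives the deletion of \<open>e\<close>
  and still bounds the stability number by its old value.\<close>

lemma critical_edge_in_tight_matching:
  assumes "simple_graph G" "matching G M" "alpha G + card M = order G" "e \<in> critical_edges G"
  shows "e \<in> M"
proof (rule ccontr)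
  assume "e \<notin> M"
  then have "matching (delete_edge G e) M"
    using assms(2) by (auto simp: matching_def delete_edge_def)
  moreover obtain S where "stable (delete_edge G e) S" "card S = alpha (delete_edge G e)"
    using alpha_attained[OF simple_graph_delete_edge[OF assms(1)]] by blast
  ultimately have "alpha (delete_edge G e) + card M \<le> order (delete_edge G e)"
    using card_stable_matching_le[OF simple_graph_delete_edge[OF assms(1)]] by metis
  moreover have "order (delete_edge G e) = order G"
    by (simp add: order_def delete_edge_def)
  ultimately show False
    using assms(3,4) by (simp add: critical_edges_def)
qed

lemma critical_edgeI:
  assumes "simple_graph G" "e \<in> edges G" "stable (delete_edge G e) S" "card S > alpha G"
  shows "e \<in> critical_edges G"
  using assms card_stable_le_alpha[OF simple_graph_delete_edge[OF assms(1)] assms(3)]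
  by (simp add: critical_edges_def)

text \<open>A maximum stable set of the graph without \<open>e\<close> must contain both ends of
  \<open>e\<close>, and dropping either end leaves a maximum stable set of \<open>G\<close>. So each
  end lies in some, but not all, members of \<open>Omega G\<close>.\<close>

lemma critical_edgeE:
  assumes "simple_graph G" "e \<in> critical_edges G"
  obtains S u v where "stable (delete_edge G e) S" "e = {u, v}" "u \<noteq> v" "u \<in> S" "v \<in> S"
    "S - {u} \<in> Omega G" "S - {v} \<in> Omega G"
proof -
  have e: "e \<in> edges G" "alpha G < alpha (delete_edge G e)"
    using assms(2) by (auto simp: critical_edges_def)
  obtain S where S: "stable (delete_edge G e) S" "card S = alpha (delete_edge G e)"
    using alpha_attained[OF simple_graph_delete_edge[OF assms(1)]] by blast
  obtain u v where uv: "e = {u, v}" "u \<noteq> v"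
    using simple_graph_edgeE[OF assms(1) e(1)] by metis
  have fin: "finite S"
    using finite_stable[OF simple_graph_delete_edge[OF assms(1)] S(1)] .
  have stab: "stable G T" if "T \<subseteq> S" "\<not> e \<subseteq> T" for T
    using stable_delete_edge[OF stable_subset[OF S(1) that(1)] that(2)] .
  have "e \<subseteq> S"
    using stab[OF subset_refl] card_stable_le_alpha[OF assms(1), of S] S(2) e(2) by (metis not_le)
  then have uvS: "u \<in> S" "v \<in> S" using uv by auto
  have "S - {x} \<in> Omega G" if "x \<in> e" for x
  proof -
    have st: "stable G (S - {x})" using that by (intro stab) auto
    have "card (S - {x}) = card S - 1"
      using that uvS uv fin by (intro card_Diff_singleton) auto
    with card_stable_le_alpha[OF assms(1) st] S(2) e(2)
    have "card (S - {x}) = alpha G" by linarith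
    with st show ?thesis by (simp add: Omega_def)
  qed
  then show ?thesis using that[OF S(1) uv uvS] uv by auto
qed

section \<open>Partners and alternating cycles\<close>

text \<open>The value is meaningful only at vertices covered by the matching.\<close>

definition partner :: "'a set set \<Rightarrow> 'a \<Rightarrow> 'a" where
  "partner M v = (THE w. {v, w} \<in> M)"

lemma partner_eq:
  assumes "matching G M" "{v, w} \<in> M"
  shows "partner M v = w"
  unfolding partner_def
proof (rule the_equality)
  show "{v, w} \<in> M" by fact
next
  fix w' assume "{v, w'} \<in> M"
  then have "{v, w'} = {v, w}"
    using matching_eq[OF assms(1) _ assms(2)] by blast
  then show "w' = w" by (auto simp: doubleton_eq_iff)
qed

lemma partner_edge:
  assumes "simple_graph G" "matching G M" "v \<in> \<Union> M"
  shows "{v, partner M v} \<in> M"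
proof -
  obtain e where e: "e \<in> M" "v \<in> e" using assms(3) by auto
  then obtain w where "e = {v, w}"
    using simple_graph_edgeE[OF assms(1) matching_edge[OF assms(2) e(1)]]
    by (metis insertE insert_commute singletonD)
  then show ?thesis using e partner_eq[OF assms(2)] by auto
qed

lemma partner_partner:
  assumes "simple_graph G" "matching G M" "v \<in> \<Union> M"
  shows "partner M (partner M v) = v"
  using partner_eq[OF assms(2)] partner_edge[OF assms] by (metis insert_commute)

text \<open>Take a minimal nonempty invariant subset: its image is again invariant and nonempty,
  hence equal to it, and a surjection of a finite set onto itself is injective.\<close>

lemma invariant_subset_bij:
  assumes "finite P" "P \<noteq> {}" "f ` P \<subseteq> P"
  obtains Q where "Q \<subseteq> P" "Q \<noteq> {}" "bij_betw f Q Q"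
proof -
  let ?F = "{Q. Q \<subseteq> P \<and> Q \<noteq> {} \<and> f ` Q \<subseteq> Q}"
  have "finite ?F" using assms(1) by (auto intro: finite_subset[of _ "Pow P"])
  moreover have "P \<in> ?F" using assms by auto
  ultimately have "\<exists>Q\<in>?F. \<forall>Q'\<in>?F. Q' \<subseteq> Q \<longrightarrow> Q = Q'"
    by (intro finite_has_minimal) auto
  then obtain Q where Q: "Q \<in> ?F" "\<forall>Q'\<in>?F. Q' \<subseteq> Q \<longrightarrow> Q = Q'" by (rule bexE)
  have "f ` Q = Q"
    using Q(1) Q(2)[rule_format, of "f ` Q"] by blast
  moreover have "finite Q" using Q(1) assms(1) finite_subset by auto
  ultimately have "bij_betw f Q Q"
    by (simp add: bij_betw_def finite_surj_inj)
  then show ?thesis using Q(1) that by blast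
qed

text \<open>
  Otherwise, follow a choice of arcs from \<open>u\<close> to \<open>v\<close> in \<open>P\<close>: it ends up in disjoint directed cycles,
  which are alternating cycles of \<open>M\<close>; switching along them produces a second perfect matching.
\<close>

lemma unique_perfect_matching_sink:
  assumes "simple_graph G" "perfect_matching G M" "\<And>M'. perfect_matching G M' \<Longrightarrow> M' = M"
    and "P \<subseteq> verts G" "P \<noteq> {}" "P \<inter> partner M ` P = {}"
  shows "\<exists>u\<in>P. \<forall>v\<in>P. {u, partner M v} \<in> edges G \<longrightarrow> v = u"
proof (rule ccontr)
  assume "\<not> ?thesis"
  then obtain f where f: "\<And>u. u \<in> P \<Longrightarrow> f u \<in> P \<and> {u, partner M (f u)} \<in> edges G \<and> f u \<noteq> u"
    by metis
  have M: "matching G M" "\<Union> M = verts G"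
    using assms(2) by (auto simp: perfect_matching_def)
  have finP: "finite P"
    using assms(1,4) finite_subset simple_graph_finite_verts by metis
  obtain Q where Q: "Q \<subseteq> P" "Q \<noteq> {}" "bij_betw f Q Q"
    using invariant_subset_bij[OF finP assms(5), of f] f by blast
  let ?p = "partner M"
  have pM: "{v, ?p v} \<in> M" and pp: "?p (?p v) = v" if "v \<in> P" for v
    using that partner_edge[OF assms(1) M(1)] partner_partner[OF assms(1) M(1)] assms(4) M(2)
    by auto
  have fQ: "f u \<in> Q" if "u \<in> Q" for u
    using Q(3) that by (auto simp: bij_betw_def)
  have finj: "u = u'" if "u \<in> Q" "u' \<in> Q" "f u = f u'" for u u'
    using Q(3) that by (auto simp: bij_betw_def inj_on_def)
  \<comment> \<open>The edges \<open>old\<close> of \<open>M\<close> at \<open>Q\<close> are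
    exchanged for \<open>new\<close>, in which each \<open>u\<close> takes the partner of its
    successor \<open>f u\<close>.\<close>
  define old where "old = {{u, ?p u} |u. u \<in> Q}"
  define new where "new = {{u, ?p (f u)} |u. u \<in> Q}"
  have dis1: "disjnt e e'" if e: "e \<in> M - old" and e': "e' \<in> new" for e e'
  proof -
    obtain u where u: "u \<in> Q" "e' = {u, ?p (f u)}" using e' by (auto simp: new_def)
    have "u \<notin> e"
    proof
      assume "u \<in> e"
      then have "e = {u, ?p u}"
        using matching_eq[OF M(1) _ pM[of u]] e u Q(1) by blast
      then show False using e u by (auto simp: old_def)
    qed
    moreover have "?p (f u) \<notin> e"
    proof
      assume "?p (f u) \<in> e"
      then have "e = {f u, ?p (f u)}"
        using matching_eq[OF M(1) _ pM[of "f u"]] e fQ[OF u(1)] Q(1) by blast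
      then show False using e fQ[OF u(1)] by (auto simp: old_def)
    qed
    ultimately show ?thesis using u by (auto simp: disjnt_def)
  qed
  have dis2: "disjnt e e'" if e: "e \<in> new" and e': "e' \<in> new" and ne: "e \<noteq> e'" for e e'
  proof -
    obtain u where u: "u \<in> Q" "e = {u, ?p (f u)}" using e by (auto simp: new_def)
    obtain v where v: "v \<in> Q" "e' = {v, ?p (f v)}" using e' by (auto simp: new_def)
    have "u \<noteq> v" using u v ne by auto
    moreover have "?p (f u) \<noteq> ?p (f v)"
      using pp[of "f u"] pp[of "f v"] fQ[OF u(1)] fQ[OF v(1)] Q(1) finj[OF u(1) v(1)] \<open>u \<noteq> v\<close>
      by (metis subsetD)
    \<comment> \<open>Here \<open>P\<close> must not meet the set of its partners: otherwise a left
      end could coincide with a right end.\<close>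
    moreover have "u \<noteq> ?p (f v)" "v \<noteq> ?p (f u)"
      using assms(6) fQ[OF u(1)] fQ[OF v(1)] u v Q(1) by blast+
    ultimately show ?thesis using u v by (auto simp: disjnt_def)
  qed
  have "matching G ((M - old) \<union> new)"
    unfolding matching_def
  proof
    show "M - old \<union> new \<subseteq> edges G"
      using matching_edge[OF M(1)] f Q(1) by (auto simp: new_def)
    show "pairwise disjnt (M - old \<union> new)"
    proof (rule pairwiseI)
      fix e e' assume e: "e \<in> M - old \<union> new" "e' \<in> M - old \<union> new" "e \<noteq> e'"
      have "disjnt e e'" if "e \<in> M" "e' \<in> M"
        using M(1) that e(3) by (auto simp: matching_def pairwise_def)
      then show "disjnt e e'"
        using e dis1[of e e'] dis1[of e' e] dis2[of e e'] disjnt_sym[of e' e] by blast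
    qed
  qed
  moreover have "\<Union> ((M - old) \<union> new) = verts G"
  proof
    have "\<Union> new \<subseteq> verts G"
      using f Q(1) simple_graph_edge_subset[OF assms(1)] unfolding new_def by blast
    then show "\<Union> ((M - old) \<union> new) \<subseteq> verts G" using M(2) by auto
    \<comment> \<open>As \<open>f\<close> permutes \<open>Q\<close>, the partner of \<open>u\<close>
      is taken over by the predecessor \<open>w\<close> of \<open>u\<close>.\<close>
    have "\<Union> old \<subseteq> \<Union> new"
    proof
      fix x assume "x \<in> \<Union> old"
      then obtain u where u: "u \<in> Q" "x = u \<or> x = ?p u" by (auto simp: old_def)
      obtain w where "w \<in> Q" "f w = u" using Q(3) u(1) by (metis bij_betw_def imageE)
      then have "{u, ?p (f u)} \<in> new" "{w, ?p u} \<in> new" using u(1) by (auto simp: new_def)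
      then show "x \<in> \<Union> new" using u(2) by auto
    qed
    then show "verts G \<subseteq> \<Union> ((M - old) \<union> new)" using M(2) by blast
  qed
  ultimately have eq: "(M - old) \<union> new = M"
    by (intro assms(3)) (simp add: perfect_matching_def)
  \<comment> \<open>By uniqueness the exchange changed nothing, so \<open>u\<close> and
    \<open>f u\<close> share a partner and coincide, against the choice of \<open>f\<close>.\<close>
  obtain u where u: "u \<in> Q" using Q(2) by auto
  then have "{u, ?p (f u)} \<in> M" using eq by (auto simp: new_def)
  then have "?p u = ?p (f u)" using partner_eq[OF M(1)] by blast
  then have "f u = u" using pp[of u] pp[of "f u"] fQ[OF u] u Q(1) by (metis subsetD)
  then show False using f u Q(1) by blast
qed

section \<open>Structure of a graph with a tight matching\<close>

text \<open>This is the Koenig-Egervary property with a fixed witness: by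
  \<open>card_stable_matching_le\<close>, such an \<open>M\<close> is a maximum matching.\<close>

locale tight_matching =
  fixes G :: "'a graph" and M :: "'a set set"
  assumes simple: "simple_graph G" and matching: "matching G M"
    and tight: "alpha G + card M = order G"
begin

definition anticore :: "'a set" where
  "anticore = (\<Inter>S\<in>Omega G. verts G - S)"

text \<open>This turns out to be the vertex set of \<open>G0\<close>, once \<open>anticore\<close>
  is identified with the neighbourhood of the core.\<close>

definition rest :: "'a set" where
  "rest = verts G - core G - anticore"

definition rest_matching :: "'a set set" where
  "rest_matching = {e \<in> M. e \<subseteq> rest}"

lemma Omega_nonempty: "Omega G \<noteq> {}"
  using alpha_attained[OF simple] by (auto simp: Omega_def)

lemma Omega_subset: "S \<in> Omega G \<Longrightarrow> S \<subseteq> verts G"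
  by (simp add: Omega_def stable_def)

lemma Omega_not_edge: "S \<in> Omega G \<Longrightarrow> u \<in> S \<Longrightarrow> v \<in> S \<Longrightarrow> {u, v} \<notin> edges G"
  using stable_not_edge[OF simple, of S u v] by (simp add: Omega_def)

lemma finite_Omega: "S \<in> Omega G \<Longrightarrow> finite S"
  using finite_stable[OF simple] by (simp add: Omega_def)

lemma core_subset: "S \<in> Omega G \<Longrightarrow> core G \<subseteq> S"
  by (auto simp: core_def)

lemma anticore_disjoint: "S \<in> Omega G \<Longrightarrow> v \<in> S \<Longrightarrow> v \<notin> anticore"
  by (auto simp: anticore_def)

lemma core_verts: "core G \<subseteq> verts G"
  using Omega_nonempty core_subset Omega_subset by blast

lemma anticore_verts: "anticore \<subseteq> verts G"
  using Omega_nonempty by (auto simp: anticore_def)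

lemma rest_iff:
  "v \<in> rest \<longleftrightarrow> v \<in> verts G \<and> (\<exists>S\<in>Omega G. v \<in> S) \<and> (\<exists>S\<in>Omega G. v \<notin> S)"
  by (auto simp: rest_def core_def anticore_def)

lemma restI: "S \<in> Omega G \<Longrightarrow> v \<in> S \<Longrightarrow> T \<in> Omega G \<Longrightarrow> v \<notin> T \<Longrightarrow> v \<in> rest"
  using Omega_subset[of S] unfolding rest_iff by auto

lemma outside_Omega:
  assumes "S \<in> Omega G" "v \<in> verts G" "v \<notin> S"
  shows "{v, partner M v} \<in> M" "partner M v \<in> S"
proof -
  have "stable G S" "card S + card M = order G"
    using assms(1) tight by (auto simp: Omega_def)
  then obtain w where "w \<in> S" "{v, w} \<in> M"
    using tight_matching_covers[OF simple _ matching] assms by blast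
  then show "{v, partner M v} \<in> M" "partner M v \<in> S"
    using partner_eq[OF matching] by auto
qed

text \<open>Stability excludes both ends, and \<open>outside_Omega\<close> excludes neither.\<close>

lemma matching_edge_Omega:
  assumes "S \<in> Omega G" "{u, v} \<in> M"
  shows "u \<in> S \<longleftrightarrow> v \<notin> S"
proof -
  have uv: "{u, v} \<in> edges G" using matching_edge[OF matching assms(2)] .
  then have "u \<in> verts G" using simple_graph_edge_subset[OF simple] by blast
  then show ?thesis
    using Omega_not_edge[OF assms(1), of u v] uv outside_Omega(2)[OF assms(1), of u]
      partner_eq[OF matching assms(2)] by metis
qed

text \<open>A neighbour of a core vertex is barred from every maximum stable set. Conversely, the
  partner of a vertex that is always avoided lies in every maximum stable set, hence in the
  core.\<close>

lemma nbhd_core: "nbhd G (core G) = anticore"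
proof
  show "nbhd G (core G) \<subseteq> anticore"
    using Omega_not_edge core_subset by (fastforce simp: nbhd_def anticore_def)
  show "anticore \<subseteq> nbhd G (core G)"
  proof
    fix d assume d: "d \<in> anticore"
    then have dV: "d \<in> verts G" using anticore_verts by auto
    have out: "d \<notin> S" if "S \<in> Omega G" for S
      using d that anticore_disjoint by blast
    have "partner M d \<in> core G"
      using outside_Omega(2)[OF _ dV] out by (auto simp: core_def)
    moreover have "{partner M d, d} \<in> edges G"
      using outside_Omega(1)[OF _ dV] out Omega_nonempty matching_edge[OF matching]
      by (metis all_not_in_conv insert_commute)
    ultimately show "d \<in> nbhd G (core G)" using dV by (auto simp: nbhd_def)
  qed
qed

text \<open>The two ends of an edge of \<open>M\<close> have opposite membership in each maximum
  stable set, so lying in some but not all of them passes from \<open>v\<close> to its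
  partner.\<close>

lemma rest_partner:
  assumes "v \<in> rest"
  shows "{v, partner M v} \<in> M" "partner M v \<in> rest"
proof -
  have v: "v \<in> verts G" using assms by (simp add: rest_def)
  then show pM: "{v, partner M v} \<in> M"
    using assms outside_Omega(1) by (auto simp: rest_iff)
  then have "partner M v \<in> verts G"
    using simple_graph_edge_subset[OF simple matching_edge[OF matching]] by blast
  then show "partner M v \<in> rest"
    using assms matching_edge_Omega[OF _ pM] by (auto simp: rest_iff)
qed

lemma partner_partner_rest: "v \<in> rest \<Longrightarrow> partner M (partner M v) = v"
  using partner_partner[OF simple matching] rest_partner(1) by blast

lemma rest_matching_edge: "v \<in> rest \<Longrightarrow> {v, partner M v} \<in> rest_matching"
  using rest_partner by (auto simp: rest_matching_def)

text \<open>Allows the sink lemma, applied in \<open>G0\<close> with \<open>rest_matching\<close>,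
  to be read in terms of partners under \<open>M\<close>.\<close>

lemma partner_rest_matching:
  assumes "v \<in> rest"
  shows "partner rest_matching v = partner M v"
proof (rule partner_eq)
  show "matching G rest_matching"
    using matching by (auto simp: rest_matching_def matching_def pairwise_def)
qed (rule rest_matching_edge[OF assms])

section \<open>The graph \<open>G0\<close> and the numerical identities\<close>

abbreviation G0 :: "'a graph" where
  "G0 \<equiv> delete_verts G (closed_nbhd G (core G))"

lemma verts_G0: "verts G0 = rest"
  by (auto simp: delete_verts_def closed_nbhd_def nbhd_core rest_def)

lemma edges_G0: "edges G0 = {e \<in> edges G. e \<subseteq> rest}"
  using verts_G0 by (simp add: delete_verts_def)

lemma simple_G0: "simple_graph G0"
  using simple_graph_delete_verts[OF simple] .

lemma perfect_rest_matching: "perfect_matching G0 rest_matching"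
proof -
  have "matching G0 rest_matching"
    unfolding matching_def edges_G0
    using matching by (auto simp: rest_matching_def matching_def pairwise_def)
  moreover have "\<Union> rest_matching = rest"
    using rest_matching_edge by (auto simp: rest_matching_def)
  ultimately show ?thesis by (simp add: perfect_matching_def verts_G0)
qed

lemma card_rest: "card rest = 2 * card rest_matching"
  using perfect_matching_card[OF simple_G0 perfect_rest_matching] by (simp add: verts_G0)

lemma finite_rest: "finite rest"
  using simple_graph_finite_verts[OF simple] by (simp add: rest_def)

text \<open>Taking partners exchanges \<open>S \<inter> rest\<close> and \<open>rest - S\<close>, so
  \<open>S\<close> contains exactly half of \<open>rest\<close>.\<close>

lemma card_Omega_rest:
  assumes "S \<in> Omega G"
  shows "card (S \<inter> rest) = card rest_matching"
proof -
  have flip: "partner M v \<in> S \<longleftrightarrow> v \<notin> S" if "v \<in> rest" for v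
    using matching_edge_Omega[OF assms rest_partner(1)[OF that]] by auto
  have "bij_betw (partner M) (S \<inter> rest) (rest - S)"
    by (rule bij_betw_byWitness[where f' = "partner M"])
      (auto simp: flip partner_partner_rest rest_partner)
  then have "card (S \<inter> rest) = card (rest - S)" by (rule bij_betw_same_card)
  moreover have "card (S \<inter> rest) + card (rest - S) = card rest"
    using finite_rest by (metis Int_commute card_Int_Diff)
  ultimately show ?thesis using card_rest by simp
qed

lemma Omega_split: "S \<in> Omega G \<Longrightarrow> S = core G \<union> (S \<inter> rest)"
  using core_subset[of S] anticore_disjoint[of S] Omega_subset[of S] by (auto simp: rest_def)

lemma alpha_eq: "alpha G = xi G + card rest_matching"
proof -
  obtain S where S: "S \<in> Omega G" using Omega_nonempty by auto
  have "card S = card (core G) + card (S \<inter> rest)"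
    using Omega_split[OF S] finite_Omega[OF S] finite_rest
    by (metis (no_types, lifting) DiffD1 DiffD2 Int_iff card_Un_disjoint disjoint_iff finite_Un
        rest_def)
  then show ?thesis using S card_Omega_rest[OF S] by (simp add: Omega_def xi_def)
qed

lemma order_eq: "order G = xi G + 2 * card rest_matching + sigma G"
proof -
  have disj: "core G \<inter> anticore = {}"
    using Omega_nonempty core_subset anticore_disjoint by blast
  have eq: "verts G = (core G \<union> anticore) \<union> rest"
    using core_verts anticore_verts by (auto simp: rest_def)
  have fin: "finite (core G)" "finite anticore"
    using core_verts anticore_verts simple_graph_finite_verts[OF simple] finite_subset by metis+
  have "card (verts G) = card (core G \<union> anticore) + card rest"
    unfolding eq using fin finite_rest by (intro card_Un_disjoint) (auto simp: rest_def)
  also have "card (core G \<union> anticore) = card (core G) + card anticore"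
    using fin disj by (rule card_Un_disjoint)
  finally show ?thesis
    using card_rest by (simp add: order_def xi_def sigma_def anticore_def)
qed

lemma card_matching_eq: "card M = sigma G + card rest_matching"
  using tight alpha_eq order_eq by simp

text \<open>The perfect matching gives the upper bound, the trace on \<open>rest\<close> of a
  maximum stable set the lower one. Hence \<open>G0\<close> is Koenig-Egervary too.\<close>

lemma alpha_G0: "alpha G0 = card rest_matching"
proof (rule antisym)
  obtain T where "stable G0 T" "card T = alpha G0"
    using alpha_attained[OF simple_G0] by blast
  then have "alpha G0 + card rest_matching \<le> card rest"
    using card_stable_matching_le[OF simple_G0] perfect_rest_matching verts_G0
    by (metis order_def perfect_matching_def)
  then show "alpha G0 \<le> card rest_matching" using card_rest by simp
  obtain S where S: "S \<in> Omega G" using Omega_nonempty by auto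
  then have "stable G0 (S \<inter> rest)"
    unfolding stable_def verts_G0 edges_G0 by (auto simp: Omega_def stable_def indep_def)
  then show "card rest_matching \<le> alpha G0"
    using card_stable_le_alpha[OF simple_G0] card_Omega_rest[OF S] by metis
qed

section \<open>Critical edges of \<open>G\<close> and of \<open>G0\<close>\<close>

lemma critical_edges_G0_subset:
  assumes "perfect_matching G0 M'"
  shows "critical_edges G0 \<subseteq> M'"
proof
  fix e assume e: "e \<in> critical_edges G0"
  have "2 * card M' = 2 * card rest_matching"
    using perfect_matching_card[OF simple_G0 assms] card_rest by (simp add: verts_G0)
  then have "alpha G0 + card M' = order G0"
    by (simp add: alpha_G0 order_def verts_G0 card_rest)
  then show "e \<in> M'"
    using critical_edge_in_tight_matching[OF simple_G0 _ _ e] assms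
    by (simp add: perfect_matching_def)
qed

text \<open>Oversized stable sets are carried across: from \<open>G\<close> to \<open>G0\<close> by
  intersecting with \<open>rest\<close>, back by adding the core, which has no neighbour in
  \<open>rest\<close>.\<close>

lemma critical_edges_G0: "critical_edges G0 = critical_edges G"
proof
  show "critical_edges G \<subseteq> critical_edges G0"
  proof
    fix e assume e: "e \<in> critical_edges G"
    then obtain S u v where S: "stable (delete_edge G e) S" "e = {u, v}" "u \<noteq> v" "u \<in> S" "v \<in> S"
      "S - {u} \<in> Omega G" "S - {v} \<in> Omega G"
      using critical_edgeE[OF simple] by metis
    have eE: "e \<in> edges G" using e by (simp add: critical_edges_def)
    have "u \<in> S - {v}" "v \<notin> S - {v}" "v \<in> S - {u}" "u \<notin> S - {u}"
      using S(3-5) by auto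
    then have rest: "u \<in> rest" "v \<in> rest"
      using restI[OF S(7) _ S(6)] restI[OF S(6) _ S(7)] by simp_all
    \<comment> \<open>Since \<open>S - {u}\<close> already meets \<open>rest\<close> in
      \<alpha>(\<open>G0\<close>) vertices, restoring \<open>u\<close> exceeds that number by
      one.\<close>
    have "S \<inter> rest = insert u ((S - {u}) \<inter> rest)" using S rest by auto
    then have "card (S \<inter> rest) = Suc (card ((S - {u}) \<inter> rest))"
      using finite_rest by simp
    then have "card (S \<inter> rest) > alpha G0"
      using card_Omega_rest[OF S(6)] alpha_G0 by simp
    moreover have "stable (delete_edge G0 e) (S \<inter> rest)"
      using S(1) verts_G0 edges_G0 unfolding stable_def indep_def delete_edge_def by auto
    moreover have "e \<in> edges G0" using eE rest S(2) edges_G0 by auto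
    ultimately show "e \<in> critical_edges G0" using critical_edgeI[OF simple_G0] by blast
  qed
  show "critical_edges G0 \<subseteq> critical_edges G"
  proof
    fix e assume e: "e \<in> critical_edges G0"
    then have eE: "e \<in> edges G" "e \<subseteq> rest"
      by (auto simp: critical_edges_def edges_G0)
    obtain S where S: "stable (delete_edge G0 e) S" "card S = alpha (delete_edge G0 e)"
      using alpha_attained[OF simple_graph_delete_edge[OF simple_G0]] by blast
    have SV: "S \<subseteq> rest" using S(1) verts_G0 by (simp add: stable_def delete_edge_def)
    have SE: "{v, w} = e \<or> {v, w} \<notin> edges G" if "v \<in> S" "w \<in> S" "v \<noteq> w" for v w
    proof -
      have "{v, w} \<notin> edges G0 - {e}"
        using S(1) that by (simp add: stable_def indep_def delete_edge_def)
      moreover have "{v, w} \<subseteq> rest" using that SV by blast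
      ultimately show ?thesis unfolding edges_G0 by blast
    qed
    have CE: "{v, w} \<notin> edges G" if "v \<in> core G" "w \<in> core G \<union> S" for v w
      using that(2)
    proof
      assume "w \<in> core G"
      then show ?thesis using that(1) Omega_nonempty core_subset Omega_not_edge by blast
    next
      assume "w \<in> S"
      then have "w \<in> verts G" "w \<notin> nbhd G (core G)"
        using SV by (auto simp: rest_def nbhd_core)
      then show ?thesis using that(1) by (auto simp: nbhd_def)
    qed
    have "stable (delete_edge G e) (core G \<union> S)"
      unfolding stable_def indep_def
    proof (intro conjI ballI impI)
      show "core G \<union> S \<subseteq> verts (delete_edge G e)"
        using core_verts SV by (auto simp: delete_edge_def rest_def)
      fix v w assume vw: "v \<in> core G \<union> S" "w \<in> core G \<union> S" "v \<noteq> w"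
      then have "{v, w} = e \<or> {v, w} \<notin> edges G"
        using CE[of v w] CE[of w v] SE[of v w] insert_commute[of v w "{}"] by (metis UnE)
      then show "{v, w} \<notin> edges (delete_edge G e)" by (auto simp: delete_edge_def)
    qed
    moreover have "card (core G \<union> S) = xi G + card S"
      unfolding xi_def
    proof (rule card_Un_disjoint)
      show "finite (core G)" "finite S"
        using core_verts simple_graph_finite_verts[OF simple] SV finite_rest finite_subset by metis+
      show "core G \<inter> S = {}" using SV by (auto simp: rest_def)
    qed
    moreover have "card S > card rest_matching"
      using S(2) e alpha_G0 by (simp add: critical_edges_def)
    ultimately show "e \<in> critical_edges G"
      using critical_edgeI[OF simple eE(1)] alpha_eq by fastforce
  qed
qed

text \<open>Trading part of \<open>S - T\<close> for its partners in \<open>T\<close> preserves the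
  size of \<open>S\<close>; keeping \<open>a\<close> while also adding its partner \<open>b\<close>
  gains one vertex.\<close>

lemma rest_matching_critical:
  assumes unique: "\<And>M'. perfect_matching G0 M' \<Longrightarrow> M' = rest_matching"
  shows "rest_matching \<subseteq> critical_edges G"
proof
  fix e assume e: "e \<in> rest_matching"
  then have eM: "e \<in> M" "e \<subseteq> rest" by (auto simp: rest_matching_def)
  have eE: "e \<in> edges G" using matching_edge[OF matching eM(1)] .
  obtain a b where ab: "e = {a, b}" "a \<noteq> b"
    using simple_graph_edgeE[OF simple eE] by metis
  have rest: "a \<in> rest" "b \<in> rest" using eM(2) ab(1) by auto
  let ?p = "partner M"
  have pa: "?p a = b" using partner_eq[OF matching] eM(1) ab(1) by auto
  obtain S where S: "S \<in> Omega G" "a \<in> S" using rest(1) by (auto simp: rest_iff)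
  obtain T where T: "T \<in> Omega G" "b \<in> T" using rest(2) by (auto simp: rest_iff)
  have bS: "b \<notin> S" and aT: "a \<notin> T"
    using matching_edge_Omega[of _ a b] S T eM(1) ab(1) by auto
  define P where "P = S - T"
  have Prest: "P \<subseteq> rest"
    using restI[OF S(1) _ T(1)] by (auto simp: P_def)
  have aP: "a \<in> P" using S(2) aT by (simp add: P_def)
  have flip: "?p v \<in> X \<longleftrightarrow> v \<notin> X" if "v \<in> rest" "X \<in> Omega G" for v X
    using matching_edge_Omega[OF that(2) rest_partner(1)[OF that(1)]] by auto
  have pP: "?p v \<in> T - S" if "v \<in> P" for v
    using flip[of v S] flip[of v T] that Prest S(1) T(1) by (auto simp: P_def)
  have pinj: "inj_on ?p P"
    using partner_partner_rest Prest by (intro inj_on_inverseI[of _ ?p]) auto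
  define R where "R = {(u, v). u \<in> P \<and> v \<in> P \<and> u \<noteq> v \<and> {u, ?p v} \<in> edges G}"
  have acyclic: "(a, a) \<notin> R\<^sup>+"
  proof
    assume cyc: "(a, a) \<in> R\<^sup>+"
    \<comment> \<open>The strong component of \<open>a\<close>. A sink \<open>u\<close> of it still
      has a path back to \<open>a\<close>, and the first vertex \<open>w\<close> on that path lies
      in \<open>Q\<close> again, a contradiction.\<close>
    define Q where "Q = {x \<in> P. (a, x) \<in> R\<^sup>* \<and> (x, a) \<in> R\<^sup>+}"
    have "a \<in> Q" using cyc aP by (simp add: Q_def)
    have QP: "Q \<subseteq> P" by (auto simp: Q_def)
    have pQ: "partner rest_matching v = ?p v" if "v \<in> Q" for v
      using that QP Prest partner_rest_matching by blast
    have "Q \<inter> partner rest_matching ` Q = {}"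
      using pP QP pQ by (fastforce simp: P_def)
    then have "\<exists>u\<in>Q. \<forall>v\<in>Q. {u, partner rest_matching v} \<in> edges G0 \<longrightarrow> v = u"
      using unique_perfect_matching_sink[OF simple_G0 perfect_rest_matching unique, of Q]
        \<open>a \<in> Q\<close> QP Prest verts_G0 by blast
    then obtain u where u: "u \<in> Q" "\<And>v. v \<in> Q \<Longrightarrow> {u, ?p v} \<in> edges G0 \<Longrightarrow> v = u"
      using pQ by metis
    then have "(a, u) \<in> R\<^sup>*" "(u, a) \<in> R\<^sup>+" by (auto simp: Q_def)
    then obtain w where w: "(u, w) \<in> R" "(w, a) \<in> R\<^sup>*" by (meson tranclD)
    have "(a, w) \<in> R\<^sup>*" using \<open>(a, u) \<in> R\<^sup>*\<close> w(1) by (rule rtrancl_into_rtrancl)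
    moreover from this have "(w, a) \<in> R\<^sup>+"
      \<comment> \<open>If \<open>w = a\<close>, the assumed cycle supplies the nonempty
        path.\<close>
      using w(2) cyc by (metis rtrancl_eq_or_trancl)
    ultimately have "w \<in> Q" using w(1) by (auto simp: Q_def R_def)
    moreover have "{u, ?p w} \<in> edges G0"
      using w(1) Prest rest_partner(2)[of w] by (auto simp: R_def edges_G0)
    ultimately have "w = u" using u(2) by blast
    then show False using w(1) by (simp add: R_def)
  qed
  define D where "D = {v \<in> P. (a, v) \<in> R\<^sup>*}"
  have DP: "D \<subseteq> P" by (auto simp: D_def)
  have aD: "a \<in> D" using aP by (simp add: D_def)
  \<comment> \<open>\<open>D\<close> is closed under arcs, so selecting \<open>D\<close> and the partners of \<open>P - D\<close> creates no conflict;
     as no arc returns to \<open>a\<close>, its partner \<open>b\<close> can be added with \<open>e\<close> as the only conflict.\<close>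
  define A where "A = (S \<inter> T) \<union> D"
  define B where "B = insert b (?p ` (P - D))"
  have AS: "A \<subseteq> S" using DP by (auto simp: A_def P_def)
  have BT: "B \<subseteq> T - S" using pP T(2) bS by (auto simp: B_def)
  have AB: "{u, w} \<notin> edges G - {e}" if u: "u \<in> A" and w: "w \<in> B" for u w
  proof
    assume uw: "{u, w} \<in> edges G - {e}"
    \<comment> \<open>Vertices of \<open>S \<inter> T\<close> cannot conflict with \<open>B\<close>,
      which lies in \<open>T\<close>; only \<open>D\<close> has to be examined.\<close>
    have "w \<in> T" using w BT by auto
    then have "u \<notin> T" using uw Omega_not_edge[OF T(1)] by blast
    then have uD: "u \<in> D" using u by (auto simp: A_def)
    then have uP: "u \<in> P" and au: "(a, u) \<in> R\<^sup>*" by (auto simp: D_def)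
    from w consider "w = b" | v where "v \<in> P - D" "w = ?p v" by (auto simp: B_def)
    then show False
    proof cases
      case 1
      then have "u \<noteq> a" using uw ab(1) by auto
      then have "(u, a) \<in> R" using uw 1 uP aP pa by (auto simp: R_def)
      then show False using au acyclic by (meson rtrancl_into_trancl1)
    next
      case 2
      then have "(u, v) \<in> R" using uw uP uD by (auto simp: R_def)
      then have "v \<in> D" using au 2 by (auto simp: D_def intro: rtrancl_into_rtrancl)
      then show False using 2 by blast
    qed
  qed
  have "stable (delete_edge G e) (A \<union> B)"
    unfolding stable_def indep_def
  proof (intro conjI ballI impI)
    show "A \<union> B \<subseteq> verts (delete_edge G e)"
      using AS BT Omega_subset[OF S(1)] Omega_subset[OF T(1)] by (auto simp: delete_edge_def)
    fix u w assume uw: "u \<in> A \<union> B" "w \<in> A \<union> B" "u \<noteq> w"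
    \<comment> \<open>Pairs inside \<open>A\<close> lie in \<open>S\<close> and pairs inside
      \<open>B\<close> lie in \<open>T\<close>, so only mixed pairs need \<open>AB\<close>.\<close>
    consider "u \<in> S" "w \<in> S" | "u \<in> T" "w \<in> T" | "u \<in> A" "w \<in> B" | "w \<in> A" "u \<in> B"
      using uw AS BT by blast
    then have "{u, w} \<notin> edges G - {e}"
      using Omega_not_edge[OF S(1), of u w] Omega_not_edge[OF T(1), of u w] AB[of u w] AB[of w u]
      by cases (simp_all add: insert_commute)
    then show "{u, w} \<notin> edges (delete_edge G e)" by (simp add: delete_edge_def)
  qed
  moreover have "card (A \<union> B) = Suc (alpha G)"
  proof -
    have fin: "finite S" "finite P" "finite D"
      using finite_Omega[OF S(1)] DP by (auto simp: P_def intro: finite_subset)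
    have "card (?p ` (P - D)) = card (P - D)"
      using pinj by (intro card_image) (auto intro: inj_on_subset)
    \<comment> \<open>The extra vertex is new: \<open>b\<close> is the partner of \<open>a\<close>,
      which lies in \<open>D\<close>, and partners are injective on \<open>P\<close>.\<close>
    moreover have "b \<notin> ?p ` (P - D)"
    proof
      assume "b \<in> ?p ` (P - D)"
      then obtain v where "v \<in> P - D" "?p v = ?p a" using pa by auto
      then show False using pinj aP aD by (auto simp: inj_on_def)
    qed
    ultimately have cB: "card B = Suc (card (P - D))"
      using fin by (simp add: B_def)
    have cA: "card A = card (S \<inter> T) + card D"
      unfolding A_def using fin DP by (intro card_Un_disjoint) (auto simp: P_def)
    have "card P = card D + card (P - D)"
      using fin DP by (metis card_Diff_subset card_mono le_add_diff_inverse)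
    moreover have "card S = card (S \<inter> T) + card P"
      unfolding P_def using fin(1) by (simp add: card_Int_Diff)
    moreover have "card (A \<union> B) = card A + card B"
      using AS BT fin finite_Omega[OF T(1)]
      by (intro card_Un_disjoint) (auto intro: finite_subset)
    ultimately show ?thesis
      using cA cB S(1) by (simp add: Omega_def)
  qed
  ultimately show "e \<in> critical_edges G"
    using critical_edgeI[OF simple eE] by simp
qed

section \<open>The equivalences\<close>

lemma critical_subset_rest_matching: "critical_edges G \<subseteq> rest_matching"
  using critical_edges_G0_subset[OF perfect_rest_matching] critical_edges_G0 by simp

lemma finite_rest_matching: "finite rest_matching"
  using finite_matching[OF simple matching] by (simp add: rest_matching_def)

text \<open>By the inclusion above, equal cardinalities already force equal sets; this links the
  numerical conditions to the structural ones.\<close>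

lemma eta_eq_iff: "eta G = card rest_matching \<longleftrightarrow> critical_edges G = rest_matching"
  using card_subset_eq[OF finite_rest_matching critical_subset_rest_matching]
  by (auto simp: eta_def)

text \<open>For the converse, every perfect matching of \<open>G0\<close> contains the critical
  edges, and all perfect matchings have the same size.\<close>

lemma unique_perfect_matching_iff:
  "(\<exists>!M'. perfect_matching G0 M') \<longleftrightarrow> critical_edges G = rest_matching"
proof
  assume ex1: "\<exists>!M'. perfect_matching G0 M'"
  then have "M' = rest_matching" if "perfect_matching G0 M'" for M'
    using that perfect_rest_matching by blast
  then show "critical_edges G = rest_matching"
    using rest_matching_critical critical_subset_rest_matching by blast
next
  assume eq: "critical_edges G = rest_matching"
  have "M' = rest_matching" if M': "perfect_matching G0 M'" for M'
  proof -
    have "rest_matching \<subseteq> M'"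
      using critical_edges_G0_subset[OF M'] critical_edges_G0 eq by simp
    moreover have "card M' = card rest_matching"
      using perfect_matching_card[OF simple_G0 M'] card_rest verts_G0 by simp
    moreover have "finite M'"
      using M' finite_matching[OF simple_G0] by (simp add: perfect_matching_def)
    ultimately show ?thesis by (metis card_subset_eq)
  qed
  then show "\<exists>!M'. perfect_matching G0 M'" using perfect_rest_matching by blast
qed

text \<open>The critical edges lie in the matching \<open>rest_matching\<close>, so maximality
  forces equality. Conversely, a perfect matching leaves no vertex free for a further edge.\<close>

lemma maximal_matching_iff:
  "maximal_matching G0 (critical_edges G0) \<longleftrightarrow> critical_edges G = rest_matching"
proof
  assume "maximal_matching G0 (critical_edges G0)"
  then show "critical_edges G = rest_matching"
    using perfect_rest_matching critical_subset_rest_matching critical_edges_G0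
    by (auto simp: maximal_matching_def perfect_matching_def)
next
  assume eq: "critical_edges G = rest_matching"
  have "M' = rest_matching" if M': "matching G0 M'" "rest_matching \<subseteq> M'" for M'
  proof (rule ccontr)
    assume "M' \<noteq> rest_matching"
    then obtain e where e: "e \<in> M'" "e \<notin> rest_matching" using M'(2) by blast
    obtain u v where uv: "e = {u, v}" "u \<in> verts G0"
      using simple_graph_edgeE[OF simple_G0 matching_edge[OF M'(1) e(1)]] by metis
    then have "u \<in> e" "{u, partner M u} \<in> rest_matching"
      using rest_matching_edge verts_G0 by auto
    then have "e = {u, partner M u}"
      using matching_eq[OF M'(1) e(1)] M'(2) by blast
    then show False using e(2) \<open>{u, partner M u} \<in> rest_matching\<close> by simp
  qed
  then show "maximal_matching G0 (critical_edges G0)"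
    using perfect_rest_matching eq critical_edges_G0
    by (auto simp: maximal_matching_def perfect_matching_def)
qed

end

theorem theorem4p2:
  fixes G G0 :: "'a graph"
  assumes "simple_graph G"
    and "connected_graph G"
    and "edges G \<noteq> {}"
    and "koenig_egervary G"
    and "G0 = delete_verts G (closed_nbhd G (core G))"
  shows "((\<exists>!M. perfect_matching G0 M) \<longleftrightarrow> maximal_matching G0 (critical_edges G0))
       \<and> (maximal_matching G0 (critical_edges G0) \<longleftrightarrow> xi G + eta G = alpha G)
       \<and> (xi G + eta G = alpha G \<longleftrightarrow> sigma G + eta G = mu G)
       \<and> (sigma G + eta G = mu G \<longleftrightarrow> xi G + 2 * eta G + sigma G = order G)"
proof -
  obtain M where M: "matching G M" "card M = mu G"
    using mu_attained[OF assms(1)] by blast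
  interpret tight_matching G M
    using assms(1,4) M by unfold_locales (simp_all add: koenig_egervary_def)
  have "xi G + eta G = alpha G \<longleftrightarrow> eta G = card rest_matching"
    "sigma G + eta G = mu G \<longleftrightarrow> eta G = card rest_matching"
    "xi G + 2 * eta G + sigma G = order G \<longleftrightarrow> eta G = card rest_matching"
    using alpha_eq card_matching_eq order_eq M(2) by auto
  then show ?thesis
    unfolding assms(5) by (simp add: unique_perfect_matching_iff maximal_matching_iff eta_eq_iff)
qed

end
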